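(* Let $R$ be a commutative ring, let $M$ and $N$ be $R$-Lie algebras, and let $\psi^M_N\colon M\times N\to N$, $(m,n)\mapsto {}^{m}n$, and $\psi^N_M\colon N\times M\to M$, $(n,m)\mapsto {}^{n}m$, be an action of $M$ on $N$ and an action of $N$ on $M$. These two actions are compatible if and only if there exist an $R$-Lie algebra $L$ and two crossed modules of $R$-Lie algebras $(M\xrightarrow{\mu}L,\psi_M)$ and $(N\xrightarrow{\nu}L,\psi_N)$ such that the two given actions are induced from those of $L$ through $\mu$ and $\nu$, that is, $\psi^M_N(m,n)=\psi_N(\mu(m),n)$ and $\psi^N_M(n,m)=\psi_M(\nu(n),m)$ for all $m\in M$, $n\in N$.
   Context: An $R$-Lie algebra is an $R$-module with an $R$-bilinear bracket satisfying $[x,x]=0$ and the Jacobi identity. An action of an $R$-Lie algebra $P$ on an $R$-Lie algebra $M$ is an $R$-bilinear map $\psi\colon P\times M\to M$, $(p,m)\mapsto {}^{p}m$, such that ${}^{[p,p']}m={}^{p}({}^{p'}m)-{}^{p'}({}^{p}m)$ and ${}^{p}[m,m']=[{}^{p}m,m']+[m,{}^{p}m']$ for all $p,p'\in P$, $m,m'\in M$. An action of $M$ on $N$ and an action of $N$ on $M$ are compatible if for all $m,m'\in M$, $n,n'\in N$: ${}^{({}^{n}m)}n'=[n',{}^{m}n]$ and ${}^{({}^{m}n)}m'=[m',{}^{n}m]$. A crossed module of $R$-Lie algebras $(M\xrightarrow{\partial}P,\psi)$ consists of a Lie algebra morphism $\partial\colon M\to P$ and an action $\psi$ of $P$ on $M$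 such that ${}^{\partial(m)}m'=[m,m']$ and $\partial({}^{p}m)=[p,\partial(m)]$ for all $m,m'\in M$, $p\in P$. *)

theory Defs
  imports "HOL-Algebra.Module"
begin

text \<open>
  The ring operations \<^const>\<open>mult\<close> and \<^const>\<open>one\<close> that a module record inherits are left
  unconstrained, exactly as in the locale \<^locale>\<open>module\<close>; the bracket is a field of its own.
\<close>

record ('r, 'm) lie_alg = "('r, 'm) module" +
  bracket :: "'m \<Rightarrow> 'm \<Rightarrow> 'm"

definition bilinear_map ::
  "('r, 'z) ring_scheme \<Rightarrow> ('r, 'a, 'x) module_scheme \<Rightarrow> ('r, 'b, 'y) module_scheme
    \<Rightarrow> ('r, 'c, 'w) module_scheme \<Rightarrow> ('a \<Rightarrow> 'b \<Rightarrow> 'c) \<Rightarrow> bool" where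
  "bilinear_map R A B C f \<longleftrightarrow>
     (\<forall>a\<in>carrier A. \<forall>b\<in>carrier B. f a b \<in> carrier C) \<and>
     (\<forall>a\<in>carrier A. \<forall>a'\<in>carrier A. \<forall>b\<in>carrier B.
        f (a \<oplus>\<^bsub>A\<^esub> a') b = f a b \<oplus>\<^bsub>C\<^esub> f a' b) \<and>
     (\<forall>a\<in>carrier A. \<forall>b\<in>carrier B. \<forall>b'\<in>carrier B.
        f a (b \<oplus>\<^bsub>B\<^esub> b') = f a b \<oplus>\<^bsub>C\<^esub> f a b') \<and>
     (\<forall>r\<in>carrier R. \<forall>a\<in>carrier A. \<forall>b\<in>carrier B.
        f (r \<odot>\<^bsub>A\<^esub> a) b = r \<odot>\<^bsub>C\<^esub> f a b \<and> f a (r \<odot>\<^bsub>B\<^esub> b) = r \<odot>\<^bsub>C\<^esub> f a b)"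

locale lie_algebra = module R L
  for R :: "('r, 'z) ring_scheme" (structure)
    and L :: "('r, 'm, 'x) lie_alg_scheme" (structure) +
  assumes bracket_bilinear: "bilinear_map R L L L (bracket L)"
    and bracket_self: "x \<in> carrier L \<Longrightarrow> bracket L x x = \<zero>\<^bsub>L\<^esub>"
    and jacobi: "\<lbrakk>x \<in> carrier L; y \<in> carrier L; z \<in> carrier L\<rbrakk> \<Longrightarrow>
      bracket L x (bracket L y z) \<oplus>\<^bsub>L\<^esub> bracket L y (bracket L z x)
        \<oplus>\<^bsub>L\<^esub> bracket L z (bracket L x y) = \<zero>\<^bsub>L\<^esub>"

definition lie_algebra_hom ::
  "('r, 'z) ring_scheme \<Rightarrow> ('r, 'm, 'x) lie_alg_scheme \<Rightarrow> ('r, 'p, 'y) lie_alg_scheme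
    \<Rightarrow> ('m \<Rightarrow> 'p) \<Rightarrow> bool" where
  "lie_algebra_hom R M P f \<longleftrightarrow>
     (\<forall>x\<in>carrier M. f x \<in> carrier P) \<and>
     (\<forall>x\<in>carrier M. \<forall>y\<in>carrier M. f (x \<oplus>\<^bsub>M\<^esub> y) = f x \<oplus>\<^bsub>P\<^esub> f y) \<and>
     (\<forall>r\<in>carrier R. \<forall>x\<in>carrier M. f (r \<odot>\<^bsub>M\<^esub> x) = r \<odot>\<^bsub>P\<^esub> f x) \<and>
     (\<forall>x\<in>carrier M. \<forall>y\<in>carrier M. f (bracket M x y) = bracket P (f x) (f y))"

definition lie_action ::
  "('r, 'z) ring_scheme \<Rightarrow> ('r, 'p, 'y) lie_alg_scheme \<Rightarrow> ('r, 'm, 'x) lie_alg_scheme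
    \<Rightarrow> ('p \<Rightarrow> 'm \<Rightarrow> 'm) \<Rightarrow> bool" where
  "lie_action R P M \<psi> \<longleftrightarrow>
     bilinear_map R P M M \<psi> \<and>
     (\<forall>p\<in>carrier P. \<forall>p'\<in>carrier P. \<forall>m\<in>carrier M.
        \<psi> (bracket P p p') m = \<psi> p (\<psi> p' m) \<ominus>\<^bsub>M\<^esub> \<psi> p' (\<psi> p m)) \<and>
     (\<forall>p\<in>carrier P. \<forall>m\<in>carrier M. \<forall>m'\<in>carrier M.
        \<psi> p (bracket M m m') = bracket M (\<psi> p m) m' \<oplus>\<^bsub>M\<^esub> bracket M m (\<psi> p m'))"

definition compatible_actions ::
  "('r, 'm, 'x) lie_alg_scheme \<Rightarrow> ('r, 'n, 'y) lie_alg_scheme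
    \<Rightarrow> ('m \<Rightarrow> 'n \<Rightarrow> 'n) \<Rightarrow> ('n \<Rightarrow> 'm \<Rightarrow> 'm) \<Rightarrow> bool" where
  "compatible_actions M N \<psi>MN \<psi>NM \<longleftrightarrow>
     (\<forall>m\<in>carrier M. \<forall>n\<in>carrier N. \<forall>n'\<in>carrier N.
        \<psi>MN (\<psi>NM n m) n' = bracket N n' (\<psi>MN m n)) \<and>
     (\<forall>m\<in>carrier M. \<forall>m'\<in>carrier M. \<forall>n\<in>carrier N.
        \<psi>NM (\<psi>MN m n) m' = bracket M m' (\<psi>NM n m))"

definition crossed_module ::
  "('r, 'z) ring_scheme \<Rightarrow> ('r, 'm, 'x) lie_alg_scheme \<Rightarrow> ('r, 'p, 'y) lie_alg_scheme
    \<Rightarrow> ('m \<Rightarrow> 'p) \<Rightarrow> ('p \<Rightarrow> 'm \<Rightarrow> 'm) \<Rightarrow> bool" where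
  "crossed_module R M P \<delta> \<psi> \<longleftrightarrow>
     lie_algebra R M \<and> lie_algebra R P \<and>
     lie_algebra_hom R M P \<delta> \<and> lie_action R P M \<psi> \<and>
     (\<forall>m\<in>carrier M. \<forall>m'\<in>carrier M. \<psi> (\<delta> m) m' = bracket M m m') \<and>
     (\<forall>p\<in>carrier P. \<forall>m\<in>carrier M. \<delta> (\<psi> p m) = bracket P p (\<delta> m))"

definition induced_through_crossed_modules ::
  "('r, 'z) ring_scheme \<Rightarrow> ('r, 'm, 'x) lie_alg_scheme \<Rightarrow> ('r, 'n, 'y) lie_alg_scheme
    \<Rightarrow> ('m \<Rightarrow> 'n \<Rightarrow> 'n) \<Rightarrow> ('n \<Rightarrow> 'm \<Rightarrow> 'm) \<Rightarrow> ('r, 'l, 'w) lie_alg_scheme \<Rightarrow> bool" where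
  "induced_through_crossed_modules R M N \<psi>MN \<psi>NM L \<longleftrightarrow>
     (\<exists>\<mu> \<psi>M \<nu> \<psi>N. crossed_module R M L \<mu> \<psi>M \<and> crossed_module R N L \<nu> \<psi>N \<and>
        (\<forall>m\<in>carrier M. \<forall>n\<in>carrier N.
           \<psi>MN m n = \<psi>N (\<mu> m) n \<and> \<psi>NM n m = \<psi>M (\<nu> n) m))"

text \<open>
  HOL cannot quantify existentially over the type of elements of an unknown Lie algebra \<open>L\<close>.
  The theorem therefore looks for \<open>L\<close> among the Lie algebras whose
  elements have type \<open>('m \<times> 'n) set\<close>, which accommodates the quotients of \<open>M \<times> N\<close>, and
  also asserts the implication from existence to compatibility for Lie algebras \<open>L\<close> over an
  arbitrary element type \<open>'l\<close>. Together the two parts give the equivalence with \<open>L\<close>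
  ranging over all types.
\<close>

end

theory Submission
  imports Defs
begin

text \<open>
  Compatibility says exactly what is needed for the product
  \<open>(m, n)(m', n') = ([m, m'] + n \<cdot> m', m \<cdot> n' + [n, n'])\<close> on \<open>M \<times> N\<close> to satisfy the left Leibniz
  identity \<open>x(yz) = (xy)z + y(xz)\<close>. In a left Leibniz algebra \<open>(xx)z = 0\<close>, so the quotient by the
  elements that multiply everything from the left to zero is a Lie algebra \<open>L\<close>, which acts
  on the Leibniz algebra by left multiplication. This action preserves \<open>M \<times> 0\<close> and \<open>0 \<times> N\<close>, and
  the two embeddings followed by the projection to \<open>L\<close> are the required crossed modules.
  Conversely, applying the action to \<open>[\<nu>(n), \<mu>(m)] = -[\<mu>(m), \<nu>(n)]\<close> gives compatibility.
\<close>

section \<open>Bilinear maps and Lie algebras\<close>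

lemma bilinear_mapD:
  assumes "bilinear_map R A B C f"
  shows bilinear_map_closed: "\<lbrakk>a \<in> carrier A; b \<in> carrier B\<rbrakk> \<Longrightarrow> f a b \<in> carrier C"
    and bilinear_map_add_left: "\<lbrakk>a \<in> carrier A; a' \<in> carrier A; b \<in> carrier B\<rbrakk>
      \<Longrightarrow> f (a \<oplus>\<^bsub>A\<^esub> a') b = f a b \<oplus>\<^bsub>C\<^esub> f a' b"
    and bilinear_map_add_right: "\<lbrakk>a \<in> carrier A; b \<in> carrier B; b' \<in> carrier B\<rbrakk>
      \<Longrightarrow> f a (b \<oplus>\<^bsub>B\<^esub> b') = f a b \<oplus>\<^bsub>C\<^esub> f a b'"
    and bilinear_map_smult_left: "\<lbrakk>r \<in> carrier R; a \<in> carrier A; b \<in> carrier B\<rbrakk>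
      \<Longrightarrow> f (r \<odot>\<^bsub>A\<^esub> a) b = r \<odot>\<^bsub>C\<^esub> f a b"
    and bilinear_map_smult_right: "\<lbrakk>r \<in> carrier R; a \<in> carrier A; b \<in> carrier B\<rbrakk>
      \<Longrightarrow> f a (r \<odot>\<^bsub>B\<^esub> b) = r \<odot>\<^bsub>C\<^esub> f a b"
  using assms unfolding bilinear_map_def by simp_all

lemma (in abelian_group) add_eq_selfD:
  assumes "x \<oplus> y = x" "x \<in> carrier G" "y \<in> carrier G"
  shows "y = \<zero>"
  using assms r_neg1[of x y] l_neg[of x] by simp

lemma bilinear_map_zero_left:
  assumes f: "bilinear_map R A B C f" and "abelian_group A" "abelian_group C" "b \<in> carrier B"
  shows "f \<zero>\<^bsub>A\<^esub> b = \<zero>\<^bsub>C\<^esub>"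
proof -
  interpret A: abelian_group A by fact
  interpret C: abelian_group C by fact
  have "f \<zero>\<^bsub>A\<^esub> b \<oplus>\<^bsub>C\<^esub> f \<zero>\<^bsub>A\<^esub> b = f \<zero>\<^bsub>A\<^esub> b"
    using bilinear_map_add_left[OF f, of "\<zero>\<^bsub>A\<^esub>" "\<zero>\<^bsub>A\<^esub>" b] assms(4) by simp
  then show ?thesis
    using C.add_eq_selfD bilinear_map_closed[OF f] assms(4) by blast
qed

lemma bilinear_map_zero_right:
  assumes f: "bilinear_map R A B C f" and "abelian_group B" "abelian_group C" "a \<in> carrier A"
  shows "f a \<zero>\<^bsub>B\<^esub> = \<zero>\<^bsub>C\<^esub>"
proof -
  interpret B: abelian_group B by fact
  interpret C: abelian_group C by fact
  have "f a \<zero>\<^bsub>B\<^esub> \<oplus>\<^bsub>C\<^esub> f a \<zero>\<^bsub>B\<^esub> = f a \<zero>\<^bsub>B\<^esub>"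
    using bilinear_map_add_right[OF f, of a "\<zero>\<^bsub>B\<^esub>" "\<zero>\<^bsub>B\<^esub>"] assms(4) by simp
  then show ?thesis
    using C.add_eq_selfD bilinear_map_closed[OF f] assms(4) by blast
qed

lemma bilinear_map_minus_right:
  assumes f: "bilinear_map R A B C f" and "abelian_group B" "abelian_group C"
    and "a \<in> carrier A" "b \<in> carrier B"
  shows "f a (\<ominus>\<^bsub>B\<^esub> b) = \<ominus>\<^bsub>C\<^esub> f a b"
proof -
  interpret B: abelian_group B by fact
  interpret C: abelian_group C by fact
  have "f a (\<ominus>\<^bsub>B\<^esub> b) \<oplus>\<^bsub>C\<^esub> f a b = \<zero>\<^bsub>C\<^esub>"
    using bilinear_map_add_right[OF f, of a "\<ominus>\<^bsub>B\<^esub> b" b] assms(4,5)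
      bilinear_map_zero_right[OF f assms(2,3)] by (simp add: B.l_neg)
  then show ?thesis
    using C.minus_equality bilinear_map_closed[OF f] assms(4,5) by auto
qed

text \<open>Expand [x + y, x + y] = 0. The hypotheses are listed separately, without the Jacobi
  identity, so that antisymmetry is available in \<open>lie_algebraI_leibniz\<close> while
  \<open>L\<close> is still being shown to be a Lie algebra.\<close>

lemma bracket_add_swap:
  assumes "module R L" and br: "bilinear_map R L L L (bracket L)"
    and self: "\<And>x. x \<in> carrier L \<Longrightarrow> bracket L x x = \<zero>\<^bsub>L\<^esub>"
    and xy: "x \<in> carrier L" "y \<in> carrier L"
  shows "bracket L x y \<oplus>\<^bsub>L\<^esub> bracket L y x = \<zero>\<^bsub>L\<^esub>"
proof -
  interpret module R L by fact
  have "bracket L (x \<oplus>\<^bsub>L\<^esub> y) (x \<oplus>\<^bsub>L\<^esub> y) =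
      bracket L x x \<oplus>\<^bsub>L\<^esub> bracket L y x \<oplus>\<^bsub>L\<^esub> (bracket L x y \<oplus>\<^bsub>L\<^esub> bracket L y y)"
    using xy by (simp add: bilinear_mapD[OF br])
  then show ?thesis
    using xy by (simp only: self M.a_closed) (simp add: bilinear_map_closed[OF br] M.a_comm)
qed

lemma (in lie_algebra) bracket_anticomm:
  assumes "x \<in> carrier L" "y \<in> carrier L"
  shows "bracket L x y = \<ominus>\<^bsub>L\<^esub> bracket L y x"
  using M.minus_equality[OF bracket_add_swap[OF module_axioms bracket_bilinear bracket_self assms]]
    bilinear_map_closed[OF bracket_bilinear] assms by simp

text \<open>Antisymmetry turns two summands of the cyclic Jacobi sum around. The resulting form, in
  which \<open>bracket L x\<close> is a derivation, is the one shared with Leibniz algebras.\<close>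

lemma (in lie_algebra) bracket_leibniz:
  assumes "x \<in> carrier L" "y \<in> carrier L" "z \<in> carrier L"
  shows "bracket L x (bracket L y z) =
    bracket L (bracket L x y) z \<oplus>\<^bsub>L\<^esub> bracket L y (bracket L x z)"
proof -
  note br = bracket_bilinear
  note [simp] = bilinear_map_closed[OF br] assms
  have 1: "bracket L z (bracket L x y) = \<ominus>\<^bsub>L\<^esub> bracket L (bracket L x y) z"
    by (rule bracket_anticomm) simp_all
  have "bracket L y (bracket L z x) = bracket L y (\<ominus>\<^bsub>L\<^esub> bracket L x z)"
    using bracket_anticomm[of z x] by simp
  also have "\<dots> = \<ominus>\<^bsub>L\<^esub> bracket L y (bracket L x z)"
    by (rule bilinear_map_minus_right[OF br]) (simp_all add: M.abelian_group_axioms)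
  finally have 2: "bracket L y (bracket L z x) = \<ominus>\<^bsub>L\<^esub> bracket L y (bracket L x z)" .
  have "bracket L x (bracket L y z) \<oplus>\<^bsub>L\<^esub>
      (\<ominus>\<^bsub>L\<^esub> bracket L y (bracket L x z) \<oplus>\<^bsub>L\<^esub> \<ominus>\<^bsub>L\<^esub> bracket L (bracket L x y) z) = \<zero>\<^bsub>L\<^esub>"
    using jacobi[of x y z] by (simp add: 1 2 M.a_assoc)
  then have "bracket L x (bracket L y z) = \<ominus>\<^bsub>L\<^esub>
      (\<ominus>\<^bsub>L\<^esub> bracket L y (bracket L x z) \<oplus>\<^bsub>L\<^esub> \<ominus>\<^bsub>L\<^esub> bracket L (bracket L x y) z)"
    by (metis M.minus_equality M.a_closed M.a_inv_closed assms bilinear_map_closed[OF br])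
  then show ?thesis
    by (simp add: M.minus_add M.a_comm)
qed

text \<open>Substituting the Leibniz identity for [x, [y, z]] regroups the cyclic sum into [[x, y],
  z] + [z, [x, y]] and [y, [x, z] + [z, x]], both zero by antisymmetry. The quotient below inherits
  the Leibniz form directly from \<open>E\<close>.\<close>

lemma lie_algebraI_leibniz:
  assumes "module R L" and br: "bilinear_map R L L L (bracket L)"
    and self: "\<And>x. x \<in> carrier L \<Longrightarrow> bracket L x x = \<zero>\<^bsub>L\<^esub>"
    and leibniz: "\<And>x y z. \<lbrakk>x \<in> carrier L; y \<in> carrier L; z \<in> carrier L\<rbrakk> \<Longrightarrow>
      bracket L x (bracket L y z) =
      bracket L (bracket L x y) z \<oplus>\<^bsub>L\<^esub> bracket L y (bracket L x z)"
  shows "lie_algebra R L"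
proof -
  interpret module R L by fact
  note swap = bracket_add_swap[OF assms(1) br self]
  show ?thesis
  proof
    fix x y z assume [simp]: "x \<in> carrier L" "y \<in> carrier L" "z \<in> carrier L"
    note [simp] = bilinear_map_closed[OF br]
    have 1: "bracket L (bracket L x y) z \<oplus>\<^bsub>L\<^esub> bracket L z (bracket L x y) = \<zero>\<^bsub>L\<^esub>"
      by (rule swap) simp_all
    have "bracket L y (bracket L x z) \<oplus>\<^bsub>L\<^esub> bracket L y (bracket L z x) =
        bracket L y (bracket L x z \<oplus>\<^bsub>L\<^esub> bracket L z x)"
      by (simp add: bilinear_map_add_right[OF br])
    then have 2: "bracket L y (bracket L x z) \<oplus>\<^bsub>L\<^esub> bracket L y (bracket L z x) = \<zero>\<^bsub>L\<^esub>"
      by (simp add: swap bilinear_map_zero_right[OF br] M.abelian_group_axioms)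
    have "bracket L x (bracket L y z) \<oplus>\<^bsub>L\<^esub> bracket L y (bracket L z x)
        \<oplus>\<^bsub>L\<^esub> bracket L z (bracket L x y) =
        (bracket L (bracket L x y) z \<oplus>\<^bsub>L\<^esub> bracket L z (bracket L x y)) \<oplus>\<^bsub>L\<^esub>
        (bracket L y (bracket L x z) \<oplus>\<^bsub>L\<^esub> bracket L y (bracket L z x))"
      by (subst leibniz) (simp_all add: M.a_ac)
    then show "bracket L x (bracket L y z) \<oplus>\<^bsub>L\<^esub> bracket L y (bracket L z x)
        \<oplus>\<^bsub>L\<^esub> bracket L z (bracket L x y) = \<zero>\<^bsub>L\<^esub>"
      by (simp add: 1 2)
  qed (use br self in simp_all)
qed

section \<open>Leibniz algebras and their Lie quotients\<close>

text \<open>Left multiplications are derivations, but squares may be nonzero: in the pair algebra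
  below, the square of (m, n) is (n.m, m.n), with the dot for the actions.\<close>

locale leibniz_algebra = module R E
  for R :: "('r, 'z) ring_scheme" (structure)
    and E :: "('r, 'e, 'x) lie_alg_scheme" (structure) +
  assumes bracket_bilinear: "bilinear_map R E E E (bracket E)"
    and leibniz: "\<lbrakk>x \<in> carrier E; y \<in> carrier E; z \<in> carrier E\<rbrakk> \<Longrightarrow>
      bracket E x (bracket E y z) =
      bracket E (bracket E x y) z \<oplus>\<^bsub>E\<^esub> bracket E y (bracket E x z)"
begin

text \<open>This is the coset of \<open>p\<close> modulo the left annihilator, the set of z with zx
  = 0 for all x. In this form, equality of classes is equality of left multiplications.\<close>

definition left_class :: "'e \<Rightarrow> 'e set" where
  "left_class p = {q \<in> carrier E. \<forall>x\<in>carrier E. bracket E q x = bracket E p x}"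

definition rep :: "'e set \<Rightarrow> 'e" where
  "rep X = (SOME p. p \<in> X)"

text \<open>Up to isomorphism this is the Lie algebra of left multiplications of \<open>E\<close>.
  Taking classes as elements is what leads to the type \<open>('m \<times> 'n) set\<close> in the
  theorem.\<close>

definition left_quotient :: "('r, 'e set) lie_alg" where
  "left_quotient = \<lparr>carrier = left_class ` carrier E,
     monoid.mult = undefined, one = undefined,
     zero = left_class \<zero>\<^bsub>E\<^esub>,
     add = (\<lambda>X Y. left_class (rep X \<oplus>\<^bsub>E\<^esub> rep Y)),
     smult = (\<lambda>r X. left_class (r \<odot>\<^bsub>E\<^esub> rep X)),
     bracket = (\<lambda>X Y. left_class (bracket E (rep X) (rep Y)))\<rparr>"

section \<open>Independence of representatives\<close>

lemma left_class_eqI: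
  assumes "\<And>x. x \<in> carrier E \<Longrightarrow> bracket E p x = bracket E q x"
  shows "left_class p = left_class q"
  unfolding left_class_def using assms by auto

text \<open>The chosen representative may differ from \<open>p\<close>. Beyond membership in the
  carrier, later computations use only that both have the same left multiplication.\<close>

lemma
  assumes "p \<in> carrier E"
  shows rep_closed [simp]: "rep (left_class p) \<in> carrier E"
    and bracket_rep: "x \<in> carrier E \<Longrightarrow> bracket E (rep (left_class p)) x = bracket E p x"
proof -
  have "p \<in> left_class p"
    using assms unfolding left_class_def by simp
  then have "rep (left_class p) \<in> left_class p"
    unfolding rep_def by (rule someI)
  then show "rep (left_class p) \<in> carrier E"
    and "x \<in> carrier E \<Longrightarrow> bracket E (rep (left_class p)) x = bracket E p x"
    unfolding left_class_def by auto
qed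

lemmas bracket_simps [simp] = bilinear_mapD[OF bracket_bilinear]

lemma carrier_left_quotient: "carrier left_quotient = left_class ` carrier E"
  unfolding left_quotient_def by simp

lemma left_quotientE:
  assumes "X \<in> carrier left_quotient"
  obtains p where "p \<in> carrier E" "X = left_class p"
  using assms unfolding carrier_left_quotient by auto

lemma left_class_closed [simp]:
  "p \<in> carrier E \<Longrightarrow> left_class p \<in> carrier left_quotient"
  unfolding carrier_left_quotient by simp

lemma zero_left_quotient: "\<zero>\<^bsub>left_quotient\<^esub> = left_class \<zero>\<^bsub>E\<^esub>"
  unfolding left_quotient_def by simp

lemma add_left_class [simp]:
  assumes "p \<in> carrier E" "q \<in> carrier E"
  shows "left_class p \<oplus>\<^bsub>left_quotient\<^esub> left_class q = left_class (p \<oplus>\<^bsub>E\<^esub> q)"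
  unfolding left_quotient_def using assms by (auto intro!: left_class_eqI simp: bracket_rep)

lemma smult_left_class [simp]:
  assumes "r \<in> carrier R" "p \<in> carrier E"
  shows "r \<odot>\<^bsub>left_quotient\<^esub> left_class p = left_class (r \<odot>\<^bsub>E\<^esub> p)"
  unfolding left_quotient_def using assms by (auto intro!: left_class_eqI simp: bracket_rep)

text \<open>
  Two elements of the same class need not be interchangeable as right factors; independence of
  representatives holds because, by the Leibniz identity, left multiplication by a product is
  the commutator of the left multiplications by its factors.
\<close>

lemma bracket_left_class [simp]:
  assumes "p \<in> carrier E" "q \<in> carrier E"
  shows "bracket left_quotient (left_class p) (left_class q) = left_class (bracket E p q)"
proof -
  have "bracket E (bracket E (rep (left_class p)) (rep (left_class q))) x =
      bracket E (bracket E p q) x" if x: "x \<in> carrier E" for x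
  proof -
    \<comment> \<open>By the Leibniz identity both sides expand p(qx): on the left for the
      representatives, on the right for \<open>p\<close> and \<open>q\<close> themselves. The common
      summand q(px) then cancels.\<close>
    have "bracket E (bracket E (rep (left_class p)) (rep (left_class q))) x
          \<oplus>\<^bsub>E\<^esub> bracket E q (bracket E p x) =
        bracket E (bracket E p q) x \<oplus>\<^bsub>E\<^esub> bracket E q (bracket E p x)"
      using leibniz[of "rep (left_class p)" "rep (left_class q)" x] leibniz[of p q x] assms x
      by (simp add: bracket_rep)
    then show ?thesis
      using assms x by simp
  qed
  then show ?thesis
    unfolding left_quotient_def by (auto intro!: left_class_eqI)
qed

section \<open>Lie algebra axioms in the quotient\<close>

lemma module_left_quotient: "module R left_quotient"
proof (rule moduleI)
  show "cring R" by (rule R.is_cring)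
  show "abelian_group left_quotient"
  proof (rule abelian_groupI)
    fix X assume "X \<in> carrier left_quotient"
    then obtain p where p: "p \<in> carrier E" "X = left_class p"
      by (rule left_quotientE)
    then have "left_class (\<ominus>\<^bsub>E\<^esub> p) \<oplus>\<^bsub>left_quotient\<^esub> X = \<zero>\<^bsub>left_quotient\<^esub>"
      by (simp add: zero_left_quotient M.l_neg)
    then show "\<exists>Y\<in>carrier left_quotient. Y \<oplus>\<^bsub>left_quotient\<^esub> X = \<zero>\<^bsub>left_quotient\<^esub>"
      using p by (meson M.a_inv_closed left_class_closed)
  qed (auto elim!: left_quotientE simp: zero_left_quotient M.a_ac)
qed (auto elim!: left_quotientE simp: smult_l_distr smult_r_distr smult_assoc1)

lemma bilinear_left_quotient:
  "bilinear_map R left_quotient left_quotient left_quotient (bracket left_quotient)"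
  unfolding bilinear_map_def by (auto elim!: left_quotientE)

lemma lie_algebra_left_quotient: "lie_algebra R left_quotient"
proof (rule lie_algebraI_leibniz[OF module_left_quotient bilinear_left_quotient])
  fix X assume "X \<in> carrier left_quotient"
  then obtain p where p: "p \<in> carrier E" "X = left_class p"
    by (rule left_quotientE)
  \<comment> \<open>The Leibniz identity for p, p, x reads p(px) = (pp)x + p(px), so every square
    lies in the left annihilator.\<close>
  have "bracket E (bracket E p p) x = bracket E \<zero>\<^bsub>E\<^esub> x" if x: "x \<in> carrier E" for x
  proof -
    have "bracket E p (bracket E p x) \<oplus>\<^bsub>E\<^esub> bracket E (bracket E p p) x =
        bracket E p (bracket E p x)"
      using leibniz[of p p x] p x by (simp add: M.a_comm)
    then have "bracket E (bracket E p p) x = \<zero>\<^bsub>E\<^esub>"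
      using p x by (intro M.add_eq_selfD) simp_all
    then show ?thesis
      using x by (simp add: bilinear_map_zero_left[OF bracket_bilinear] M.abelian_group_axioms)
  qed
  then show "bracket left_quotient X X = \<zero>\<^bsub>left_quotient\<^esub>"
    using p by (simp add: zero_left_quotient) (rule left_class_eqI)
next
  fix X Y Z
  assume "X \<in> carrier left_quotient" "Y \<in> carrier left_quotient" "Z \<in> carrier left_quotient"
  then obtain p q r where "p \<in> carrier E" "X = left_class p" "q \<in> carrier E" "Y = left_class q"
    "r \<in> carrier E" "Z = left_class r"
    by (metis left_quotientE)
  then show "bracket left_quotient X (bracket left_quotient Y Z) =
      bracket left_quotient (bracket left_quotient X Y) Z \<oplus>\<^bsub>left_quotient\<^esub>
      bracket left_quotient Y (bracket left_quotient X Z)"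
    using leibniz[of p q r] by simp
qed

text \<open>Through \<open>f\<close>, \<open>I\<close> becomes a submodule of \<open>E\<close>
  stable under left multiplication, and \<open>\<phi>\<close> is left multiplication pulled back to
  \<open>I\<close>. As \<open>f\<close> is injective, identities in \<open>I\<close> can be checked
  in \<open>E\<close>, where they follow from bilinearity and the Leibniz identity.\<close>

lemma crossed_module_left_quotient:
  fixes I :: "('r, 'i, 'w) lie_alg_scheme"
  assumes I: "lie_algebra R I" and hom: "lie_algebra_hom R I E f" and inj: "inj_on f (carrier I)"
    and closed: "\<And>e x. \<lbrakk>e \<in> carrier E; x \<in> carrier I\<rbrakk> \<Longrightarrow> \<phi> e x \<in> carrier I"
    and ideal: "\<And>e x. \<lbrakk>e \<in> carrier E; x \<in> carrier I\<rbrakk> \<Longrightarrow> f (\<phi> e x) = bracket E e (f x)"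
  shows "crossed_module R I left_quotient (\<lambda>x. left_class (f x)) (\<lambda>X. \<phi> (rep X))"
proof -
  interpret I: lie_algebra R I by fact
  note br_closed = bilinear_map_closed[OF I.bracket_bilinear]
  have f: "\<And>x. x \<in> carrier I \<Longrightarrow> f x \<in> carrier E"
    "\<And>x y. \<lbrakk>x \<in> carrier I; y \<in> carrier I\<rbrakk> \<Longrightarrow> f (x \<oplus>\<^bsub>I\<^esub> y) = f x \<oplus>\<^bsub>E\<^esub> f y"
    "\<And>x y. \<lbrakk>x \<in> carrier I; y \<in> carrier I\<rbrakk> \<Longrightarrow> f (bracket I x y) = bracket E (f x) (f y)"
    "\<And>r x. \<lbrakk>r \<in> carrier R; x \<in> carrier I\<rbrakk> \<Longrightarrow> f (r \<odot>\<^bsub>I\<^esub> x) = r \<odot>\<^bsub>E\<^esub> f x"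
    using hom unfolding lie_algebra_hom_def by auto
  have eqI: "x = y" if "x \<in> carrier I" "y \<in> carrier I" "f x = f y" for x y
    using inj that by (auto dest: inj_onD)
  \<comment> \<open>Under \<open>f\<close> this is left multiplication by \<open>p\<close>, which
    depends only on the class of \<open>p\<close>; hence the action of the quotient is well
    defined.\<close>
  have rep: "\<phi> (rep (left_class p)) x = \<phi> p x" if "p \<in> carrier E" "x \<in> carrier I" for p x
    using that by (intro eqI) (simp_all add: closed ideal f bracket_rep)
  have add: "\<phi> (p \<oplus>\<^bsub>E\<^esub> q) x = \<phi> p x \<oplus>\<^bsub>I\<^esub> \<phi> q x" "\<phi> p (x \<oplus>\<^bsub>I\<^esub> y) = \<phi> p x \<oplus>\<^bsub>I\<^esub> \<phi> p y"
    if "p \<in> carrier E" "q \<in> carrier E" "x \<in> carrier I" "y \<in> carrier I" for p q x y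
    using that by (auto intro!: eqI simp: closed ideal f)
  have smult: "\<phi> (r \<odot>\<^bsub>E\<^esub> p) x = r \<odot>\<^bsub>I\<^esub> \<phi> p x" "\<phi> p (r \<odot>\<^bsub>I\<^esub> x) = r \<odot>\<^bsub>I\<^esub> \<phi> p x"
    if "r \<in> carrier R" "p \<in> carrier E" "x \<in> carrier I" for r p x
    using that by (auto intro!: eqI simp: closed ideal f)
  have bil: "bilinear_map R left_quotient I I (\<lambda>X. \<phi> (rep X))"
    unfolding bilinear_map_def
    by (auto elim!: left_quotientE simp: closed rep add smult)
  have act: "\<phi> (rep (bracket left_quotient X Y)) x =
      \<phi> (rep X) (\<phi> (rep Y) x) \<ominus>\<^bsub>I\<^esub> \<phi> (rep Y) (\<phi> (rep X) x)"
    if XY: "X \<in> carrier left_quotient" "Y \<in> carrier left_quotient" and x: "x \<in> carrier I" for X Y x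
  proof -
    obtain p q where pq: "p \<in> carrier E" "X = left_class p" "q \<in> carrier E" "Y = left_class q"
      using XY unfolding carrier_left_quotient by blast
    \<comment> \<open>The Leibniz identity for \<open>p\<close>, \<open>q\<close>,
      \<open>f x\<close> is the bracket axiom of an action with the subtracted term on the other
      side.\<close>
    have "\<phi> p (\<phi> q x) = \<phi> (bracket E p q) x \<oplus>\<^bsub>I\<^esub> \<phi> q (\<phi> p x)"
      using leibniz[of p q "f x"] pq x by (intro eqI) (simp_all add: closed ideal f)
    then show ?thesis
      using pq x by (simp add: rep closed I.M.minus_eq I.M.a_assoc I.M.r_neg)
  qed
  have der: "\<phi> (rep X) (bracket I x y) =
      bracket I (\<phi> (rep X) x) y \<oplus>\<^bsub>I\<^esub> bracket I x (\<phi> (rep X) y)"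
    if X: "X \<in> carrier left_quotient" and xy: "x \<in> carrier I" "y \<in> carrier I" for X x y
  proof -
    obtain p where p: "p \<in> carrier E" "X = left_class p"
      using X by (rule left_quotientE)
    show ?thesis
      \<comment> \<open>With both right factors in the image of \<open>I\<close>, the same identity
        says that \<open>p\<close> acts by a derivation.\<close>
      using leibniz[of p "f x" "f y"] p xy
      by (intro eqI) (simp_all add: rep closed ideal f br_closed)
  qed
  have "lie_algebra_hom R I left_quotient (\<lambda>x. left_class (f x))"
    unfolding lie_algebra_hom_def by (simp add: f)
  moreover have "lie_action R left_quotient I (\<lambda>X. \<phi> (rep X))"
    unfolding lie_action_def using bil act der by blast
  \<comment> \<open>Under \<open>f\<close> both sides become the product of \<open>f x\<close> and
    \<open>f y\<close>, because \<open>f\<close> preserves brackets.\<close>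
  moreover have "\<phi> (rep (left_class (f x))) y = bracket I x y"
    if "x \<in> carrier I" "y \<in> carrier I" for x y
    using that by (intro eqI) (simp_all add: closed ideal f br_closed bracket_rep)
  moreover have "left_class (f (\<phi> (rep X) x)) = bracket left_quotient X (left_class (f x))"
    if "X \<in> carrier left_quotient" "x \<in> carrier I" for X x
    using that by (auto elim!: left_quotientE simp: ideal f bracket_rep)
  ultimately show ?thesis
    unfolding crossed_module_def using I lie_algebra_left_quotient by blast
qed

end

section \<open>The Leibniz algebra of a pair of compatible actions\<close>

text \<open>Left multiplication by (m, n) is block diagonal: on \<open>M\<close> it is bracketing
  with m plus the action of n, on \<open>N\<close> the action of m plus bracketing with n. Hence
  both summands are stable under it.\<close>

definition pair_algebra ::
  "('r, 'm, 'x) lie_alg_scheme \<Rightarrow> ('r, 'n, 'y) lie_alg_scheme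
    \<Rightarrow> ('m \<Rightarrow> 'n \<Rightarrow> 'n) \<Rightarrow> ('n \<Rightarrow> 'm \<Rightarrow> 'm) \<Rightarrow> ('r, 'm \<times> 'n) lie_alg" where
  "pair_algebra M N \<psi>MN \<psi>NM = \<lparr>carrier = carrier M \<times> carrier N,
     monoid.mult = undefined, one = undefined,
     zero = (\<zero>\<^bsub>M\<^esub>, \<zero>\<^bsub>N\<^esub>),
     add = (\<lambda>p q. (fst p \<oplus>\<^bsub>M\<^esub> fst q, snd p \<oplus>\<^bsub>N\<^esub> snd q)),
     smult = (\<lambda>r p. (r \<odot>\<^bsub>M\<^esub> fst p, r \<odot>\<^bsub>N\<^esub> snd p)),
     bracket = (\<lambda>p q. (bracket M (fst p) (fst q) \<oplus>\<^bsub>M\<^esub> \<psi>NM (snd p) (fst q),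
                      \<psi>MN (fst p) (snd q) \<oplus>\<^bsub>N\<^esub> bracket N (snd p) (snd q)))\<rparr>"

lemma pair_algebra_simps [simp]:
  "carrier (pair_algebra M N \<psi>MN \<psi>NM) = carrier M \<times> carrier N"
  "\<zero>\<^bsub>pair_algebra M N \<psi>MN \<psi>NM\<^esub> = (\<zero>\<^bsub>M\<^esub>, \<zero>\<^bsub>N\<^esub>)"
  "(m, n) \<oplus>\<^bsub>pair_algebra M N \<psi>MN \<psi>NM\<^esub> (m', n') = (m \<oplus>\<^bsub>M\<^esub> m', n \<oplus>\<^bsub>N\<^esub> n')"
  "r \<odot>\<^bsub>pair_algebra M N \<psi>MN \<psi>NM\<^esub> (m, n) = (r \<odot>\<^bsub>M\<^esub> m, r \<odot>\<^bsub>N\<^esub> n)"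
  "bracket (pair_algebra M N \<psi>MN \<psi>NM) (m, n) (m', n') =
    (bracket M m m' \<oplus>\<^bsub>M\<^esub> \<psi>NM n m', \<psi>MN m n' \<oplus>\<^bsub>N\<^esub> bracket N n n')"
  unfolding pair_algebra_def by simp_all

lemma lie_actionD:
  assumes "lie_action R P M \<psi>"
  shows lie_action_bilinear: "bilinear_map R P M M \<psi>"
    and lie_action_bracket: "\<lbrakk>p \<in> carrier P; p' \<in> carrier P; x \<in> carrier M\<rbrakk> \<Longrightarrow>
      \<psi> (bracket P p p') x = \<psi> p (\<psi> p' x) \<ominus>\<^bsub>M\<^esub> \<psi> p' (\<psi> p x)"
    and lie_action_derivation: "\<lbrakk>p \<in> carrier P; x \<in> carrier M; x' \<in> carrier M\<rbrakk> \<Longrightarrow>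
      \<psi> p (bracket M x x') = bracket M (\<psi> p x) x' \<oplus>\<^bsub>M\<^esub> bracket M x (\<psi> p x')"
  using assms unfolding lie_action_def by auto

lemma lie_action_compose:
  assumes "lie_algebra R M" "lie_action R P M \<psi>"
    and "p \<in> carrier P" "p' \<in> carrier P" "x \<in> carrier M"
  shows "\<psi> p (\<psi> p' x) = \<psi> (bracket P p p') x \<oplus>\<^bsub>M\<^esub> \<psi> p' (\<psi> p x)"
proof -
  interpret M: lie_algebra R M by fact
  note bilinear_map_closed[OF lie_action_bilinear[OF assms(2)]]
  then show ?thesis
    using assms(3-) by (simp add: lie_action_bracket[OF assms(2)] M.M.minus_eq M.M.a_assoc M.M.l_neg)
qed

text \<open>After expansion, the Jacobi identity, the bracket axiom of the action and the derivation
  rule for n and n' match all terms except (m.n').a + [n'.m, a] on the right. Compatibility makes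
  exactly this sum vanish.\<close>

lemma pair_algebra_leibniz_component:
  assumes M: "lie_algebra R M" and N: "lie_algebra R N"
    and MN: "lie_action R M N \<psi>MN" and NM: "lie_action R N M \<psi>NM"
    and comp: "compatible_actions M N \<psi>MN \<psi>NM"
    and mem: "m \<in> carrier M" "m' \<in> carrier M" "a \<in> carrier M" "n \<in> carrier N" "n' \<in> carrier N"
  shows "bracket M m (bracket M m' a \<oplus>\<^bsub>M\<^esub> \<psi>NM n' a) \<oplus>\<^bsub>M\<^esub> \<psi>NM n (bracket M m' a \<oplus>\<^bsub>M\<^esub> \<psi>NM n' a) =
    (bracket M (bracket M m m' \<oplus>\<^bsub>M\<^esub> \<psi>NM n m') a \<oplus>\<^bsub>M\<^esub> \<psi>NM (\<psi>MN m n' \<oplus>\<^bsub>N\<^esub> bracket N n n') a)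
    \<oplus>\<^bsub>M\<^esub> (bracket M m' (bracket M m a \<oplus>\<^bsub>M\<^esub> \<psi>NM n a) \<oplus>\<^bsub>M\<^esub> \<psi>NM n' (bracket M m a \<oplus>\<^bsub>M\<^esub> \<psi>NM n a))"
    (is "?lhs = ?rhs")
proof -
  interpret M: lie_algebra R M by fact
  interpret N: lie_algebra R N by fact
  note [simp] = mem bilinear_mapD[OF M.bracket_bilinear] bilinear_mapD[OF N.bracket_bilinear]
    bilinear_mapD[OF lie_action_bilinear[OF MN]] bilinear_mapD[OF lie_action_bilinear[OF NM]]
  have jac: "bracket M m (bracket M m' a) =
      bracket M (bracket M m m') a \<oplus>\<^bsub>M\<^esub> bracket M m' (bracket M m a)"
    by (rule M.bracket_leibniz) simp_all
  have act: "\<psi>NM n (\<psi>NM n' a) = \<psi>NM (bracket N n n') a \<oplus>\<^bsub>M\<^esub> \<psi>NM n' (\<psi>NM n a)"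
    by (rule lie_action_compose[OF M NM]) simp_all
  have "\<psi>NM (\<psi>MN m n') a = bracket M a (\<psi>NM n' m)"
    using comp unfolding compatible_actions_def by simp
  then have cancel: "\<psi>NM (\<psi>MN m n') a \<oplus>\<^bsub>M\<^esub> bracket M (\<psi>NM n' m) a = \<zero>\<^bsub>M\<^esub>"
    using M.bracket_anticomm[of a "\<psi>NM n' m"] by (simp add: M.M.l_neg)
  have "?rhs = (\<psi>NM (\<psi>MN m n') a \<oplus>\<^bsub>M\<^esub> bracket M (\<psi>NM n' m) a) \<oplus>\<^bsub>M\<^esub> ?lhs"
    by (simp add: jac act lie_action_derivation[OF NM] M.M.a_ac)
  then show ?thesis
    by (simp add: cancel)
qed

text \<open>This symmetry lets the identity for the \<open>M\<close>-component serve for the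
  \<open>N\<close>-component too.\<close>

lemma compatible_actions_swap:
  "compatible_actions M N \<psi>MN \<psi>NM \<longleftrightarrow> compatible_actions N M \<psi>NM \<psi>MN"
  unfolding compatible_actions_def by blast

lemma module_pair_algebra:
  assumes "module R M" "module R N"
  shows "module R (pair_algebra M N \<psi>MN \<psi>NM)"
proof -
  interpret M: module R M by fact
  interpret N: module R N by fact
  show ?thesis
  proof (rule moduleI)
    show "abelian_group (pair_algebra M N \<psi>MN \<psi>NM)"
    proof (rule abelian_groupI)
      fix p assume "p \<in> carrier (pair_algebra M N \<psi>MN \<psi>NM)"
      then show "\<exists>q\<in>carrier (pair_algebra M N \<psi>MN \<psi>NM).
          q \<oplus>\<^bsub>pair_algebra M N \<psi>MN \<psi>NM\<^esub> p = \<zero>\<^bsub>pair_algebra M N \<psi>MN \<psi>NM\<^esub>"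
        by (intro bexI[of _ "(\<ominus>\<^bsub>M\<^esub> fst p, \<ominus>\<^bsub>N\<^esub> snd p)"]) (auto simp: M.M.l_neg N.M.l_neg)
    qed (auto simp: M.M.a_ac N.M.a_ac)
  qed (auto simp: M.R.is_cring M.smult_l_distr N.smult_l_distr M.smult_r_distr N.smult_r_distr
      M.smult_assoc1 N.smult_assoc1)
qed

lemma leibniz_pair_algebra:
  assumes M: "lie_algebra R M" and N: "lie_algebra R N"
    and MN: "lie_action R M N \<psi>MN" and NM: "lie_action R N M \<psi>NM"
    and comp: "compatible_actions M N \<psi>MN \<psi>NM"
  shows "leibniz_algebra R (pair_algebra M N \<psi>MN \<psi>NM)"
proof -
  interpret M: lie_algebra R M by fact
  interpret N: lie_algebra R N by fact
  let ?E = "pair_algebra M N \<psi>MN \<psi>NM"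
  interpret module R ?E
    by (rule module_pair_algebra) (rule M.module_axioms N.module_axioms)+
  note bil [simp] = bilinear_mapD[OF M.bracket_bilinear] bilinear_mapD[OF N.bracket_bilinear]
    bilinear_mapD[OF lie_action_bilinear[OF MN]] bilinear_mapD[OF lie_action_bilinear[OF NM]]
  show ?thesis
  proof
    show "bilinear_map R ?E ?E ?E (bracket ?E)"
      unfolding bilinear_map_def
      by (auto simp: M.M.a_ac N.M.a_ac M.smult_r_distr N.smult_r_distr)
  next
    fix p q x assume "p \<in> carrier ?E" "q \<in> carrier ?E" "x \<in> carrier ?E"
    then obtain m n m' n' a b where eq: "p = (m, n)" "q = (m', n')" "x = (a, b)"
      and mem: "m \<in> carrier M" "n \<in> carrier N" "m' \<in> carrier M" "n' \<in> carrier N"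
        "a \<in> carrier M" "b \<in> carrier N"
      by auto
    note 1 = pair_algebra_leibniz_component[OF M N MN NM comp mem(1,3,5,2,4)]
    note 2 = pair_algebra_leibniz_component
      [OF N M NM MN comp[unfolded compatible_actions_swap[of M]] mem(2,4,6,1,3)]
    show "bracket ?E p (bracket ?E q x) =
        bracket ?E (bracket ?E p q) x \<oplus>\<^bsub>?E\<^esub> bracket ?E q (bracket ?E p x)"
      unfolding eq pair_algebra_simps prod.inject
      \<comment> \<open>The deleted rules are the additivity laws, so that products of sums stay
        unexpanded and match the two component identities. Commutativity adjusts the order of the
        summands, which exchanging \<open>M\<close> and \<open>N\<close> reverses.\<close>
      using 1 2 mem by (simp add: M.M.a_comm N.M.a_comm del: bil(2,3,7,8,12,13,17,18))
  qed
qed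

lemma induced_if_compatible:
  fixes R :: "('r, 'z) ring_scheme"
    and M :: "('r, 'm, 'x) lie_alg_scheme"
    and N :: "('r, 'n, 'y) lie_alg_scheme"
  assumes M: "lie_algebra R M" and N: "lie_algebra R N"
    and MN: "lie_action R M N \<psi>MN" and NM: "lie_action R N M \<psi>NM"
    and comp: "compatible_actions M N \<psi>MN \<psi>NM"
  shows "\<exists>L :: ('r, ('m \<times> 'n) set) lie_alg. induced_through_crossed_modules R M N \<psi>MN \<psi>NM L"
proof -
  interpret M: lie_algebra R M by fact
  interpret N: lie_algebra R N by fact
  let ?E = "pair_algebra M N \<psi>MN \<psi>NM"
  interpret E: leibniz_algebra R ?E
    by (rule leibniz_pair_algebra[OF assms])
  note [simp] = bilinear_mapD[OF M.bracket_bilinear] bilinear_mapD[OF N.bracket_bilinear]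
    bilinear_mapD[OF lie_action_bilinear[OF MN]] bilinear_mapD[OF lie_action_bilinear[OF NM]]
    bilinear_map_zero_left[OF M.bracket_bilinear] bilinear_map_zero_left[OF N.bracket_bilinear]
    bilinear_map_zero_right[OF M.bracket_bilinear] bilinear_map_zero_right[OF N.bracket_bilinear]
    bilinear_map_zero_left[OF lie_action_bilinear[OF MN]]
    bilinear_map_zero_left[OF lie_action_bilinear[OF NM]]
    bilinear_map_zero_right[OF lie_action_bilinear[OF MN]]
    bilinear_map_zero_right[OF lie_action_bilinear[OF NM]]
    M.M.abelian_group_axioms N.M.abelian_group_axioms
  let ?i = "\<lambda>m. (m, \<zero>\<^bsub>N\<^esub>)" and ?j = "\<lambda>n. (\<zero>\<^bsub>M\<^esub>, n)"
  \<comment> \<open>The discarded component of each product is zero, since actions and brackets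
    vanish at zero; this is the stability of the two embedded copies.\<close>
  let ?\<phi> = "\<lambda>e m. fst (bracket ?E e (?i m))" and ?\<chi> = "\<lambda>e n. snd (bracket ?E e (?j n))"
  have "crossed_module R M E.left_quotient (\<lambda>m. E.left_class (?i m)) (\<lambda>X. ?\<phi> (E.rep X))"
    by (rule E.crossed_module_left_quotient[OF M, where \<phi> = ?\<phi>])
      (auto simp: lie_algebra_hom_def inj_on_def)
  moreover
  have "crossed_module R N E.left_quotient (\<lambda>n. E.left_class (?j n)) (\<lambda>X. ?\<chi> (E.rep X))"
    by (rule E.crossed_module_left_quotient[OF N, where \<phi> = ?\<chi>])
      (auto simp: lie_algebra_hom_def inj_on_def)
  \<comment> \<open>\<open>E.bracket_rep\<close> replaces the chosen representative by (m, 0) or (0,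
    n), whose zero entry leaves only the given action.\<close>
  moreover have "\<psi>MN m n = ?\<chi> (E.rep (E.left_class (?i m))) n"
    "\<psi>NM n m = ?\<phi> (E.rep (E.left_class (?j n))) m" if "m \<in> carrier M" "n \<in> carrier N" for m n
    using that by (simp_all add: E.bracket_rep)
  ultimately show ?thesis
    unfolding induced_through_crossed_modules_def by blast
qed

section \<open>Compatibility of induced actions\<close>

text \<open>Both compatibility conditions come from this one, the second by exchanging the two
  crossed modules.\<close>

lemma crossed_modules_compatible_half:
  assumes CM: "crossed_module R M L \<mu> \<psi>M" and CN: "crossed_module R N L \<nu> \<psi>N"
    and m: "m \<in> carrier M" and n: "n \<in> carrier N" and n': "n' \<in> carrier N"
  shows "\<psi>N (\<mu> (\<psi>M (\<nu> n) m)) n' = bracket N n' (\<psi>N (\<mu> m) n)"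
proof -
  interpret N: lie_algebra R N using CN unfolding crossed_module_def by blast
  interpret L: lie_algebra R L using CN unfolding crossed_module_def by blast
  have \<mu>: "\<mu> m \<in> carrier L" and \<nu>: "\<And>x. x \<in> carrier N \<Longrightarrow> \<nu> x \<in> carrier L"
    using CM CN m unfolding crossed_module_def lie_algebra_hom_def by auto
  have bil: "bilinear_map R L N N \<psi>N"
    using CN lie_action_bilinear unfolding crossed_module_def by blast
  let ?k = "\<psi>N (\<mu> m) n"
  have k: "?k \<in> carrier N" by (rule bilinear_map_closed[OF bil \<mu> n])
  have "\<mu> (\<psi>M (\<nu> n) m) = bracket L (\<nu> n) (\<mu> m)"
    using CM m \<nu>[OF n] unfolding crossed_module_def by blast
  moreover have "\<nu> ?k = bracket L (\<mu> m) (\<nu> n)"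
    using CN n \<mu> unfolding crossed_module_def by blast
  \<comment> \<open>Equivariance identifies the two summands with [\<open>\<nu> n\<close>,
    \<open>\<mu> m\<close>] and [\<open>\<mu> m\<close>, \<open>\<nu> n\<close>].\<close>
  ultimately have sum: "\<mu> (\<psi>M (\<nu> n) m) \<oplus>\<^bsub>L\<^esub> \<nu> ?k = \<zero>\<^bsub>L\<^esub>"
    and cl: "\<mu> (\<psi>M (\<nu> n) m) \<in> carrier L"
    using bracket_add_swap[OF L.module_axioms L.bracket_bilinear L.bracket_self \<nu>[OF n] \<mu>]
      bilinear_map_closed[OF L.bracket_bilinear \<nu>[OF n] \<mu>] by simp_all
  have "\<psi>N (\<mu> (\<psi>M (\<nu> n) m)) n' \<oplus>\<^bsub>N\<^esub> \<psi>N (\<nu> ?k) n' = \<zero>\<^bsub>N\<^esub>"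
    using bilinear_map_add_left[OF bil cl \<nu>[OF k] n'] sum
      bilinear_map_zero_left[OF bil L.M.abelian_group_axioms N.M.abelian_group_axioms n'] by simp
  \<comment> \<open>The Peiffer identity of \<open>\<nu>\<close> turns the second summand into a
    bracket in \<open>N\<close>.\<close>
  moreover have "\<psi>N (\<nu> ?k) n' = bracket N ?k n'"
    using CN k n' unfolding crossed_module_def by blast
  ultimately have "\<psi>N (\<mu> (\<psi>M (\<nu> n) m)) n' = \<ominus>\<^bsub>N\<^esub> bracket N ?k n'"
    using N.M.minus_equality bilinear_map_closed[OF bil cl n']
      bilinear_map_closed[OF N.bracket_bilinear k n'] by metis
  then show ?thesis
    using N.bracket_anticomm[OF n' k] by simp
qed

lemma compatible_if_induced:
  assumes "induced_through_crossed_modules R M N \<psi>MN \<psi>NM L"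
  shows "compatible_actions M N \<psi>MN \<psi>NM"
proof -
  obtain \<mu> \<psi>M \<nu> \<psi>N where CM: "crossed_module R M L \<mu> \<psi>M" and CN: "crossed_module R N L \<nu> \<psi>N"
    and ind: "\<And>m n. \<lbrakk>m \<in> carrier M; n \<in> carrier N\<rbrakk> \<Longrightarrow> \<psi>MN m n = \<psi>N (\<mu> m) n"
      "\<And>m n. \<lbrakk>m \<in> carrier M; n \<in> carrier N\<rbrakk> \<Longrightarrow> \<psi>NM n m = \<psi>M (\<nu> n) m"
    using assms unfolding induced_through_crossed_modules_def by blast
  \<comment> \<open>In the compatibility conditions one action occurs inside the other; the outer
    one can be rewritten by \<open>ind\<close> only once the inner value is known to lie in the
    carrier.\<close>
  have closed: "\<psi>M (\<nu> n) m \<in> carrier M" "\<psi>N (\<mu> m) n \<in> carrier N"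
    if "m \<in> carrier M" "n \<in> carrier N" for m n
    using CM CN that
    unfolding crossed_module_def lie_action_def bilinear_map_def lie_algebra_hom_def by simp_all
  show ?thesis
    unfolding compatible_actions_def
    using crossed_modules_compatible_half[OF CM CN] crossed_modules_compatible_half[OF CN CM]
    by (simp add: ind closed)
qed

theorem theorem2p17:
  fixes R :: "('r, 'z) ring_scheme"
    and M :: "('r, 'm, 'x) lie_alg_scheme"
    and N :: "('r, 'n, 'y) lie_alg_scheme"
    and \<psi>MN :: "'m \<Rightarrow> 'n \<Rightarrow> 'n"
    and \<psi>NM :: "'n \<Rightarrow> 'm \<Rightarrow> 'm"
  assumes "cring R"
    and "lie_algebra R M"
    and "lie_algebra R N"
    and "lie_action R M N \<psi>MN"
    and "lie_action R N M \<psi>NM"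
  shows "(compatible_actions M N \<psi>MN \<psi>NM \<longleftrightarrow>
            (\<exists>L :: ('r, ('m \<times> 'n) set) lie_alg.
               induced_through_crossed_modules R M N \<psi>MN \<psi>NM L)) \<and>
         (\<forall>L :: ('r, 'l, 'w) lie_alg_scheme.
            induced_through_crossed_modules R M N \<psi>MN \<psi>NM L
              \<longrightarrow> compatible_actions M N \<psi>MN \<psi>NM)"
proof (intro conjI iffI allI impI)
  assume "compatible_actions M N \<psi>MN \<psi>NM"
  with assms(2-5) show "\<exists>L :: ('r, ('m \<times> 'n) set) lie_alg.
      induced_through_crossed_modules R M N \<psi>MN \<psi>NM L"
    by (rule induced_if_compatible)
\<comment> \<open>\<open>compatible_if_induced\<close> is polymorphic in the element type of
  \<open>L\<close>, so it settles both remaining implications.\<close>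
qed (auto intro: compatible_if_induced)

end
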